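(* Let $a,b,c,d,q$ be complex numbers and consider the continued fraction \[ H(a,b,c,d,q)= \cfrac{1}{1+\cfrac{-ab+cq}{a+b+dq+\cfrac{-ab+cq^2}{a+b+dq^2+\cdots}}}, \] i.e. $H=\mathrm{K}_{n=1}^{\infty}\alpha_n/\beta_n$ with $\alpha_1=\beta_1=1$ and, for $n\ge 1$, $\alpha_{n+1}=-ab+cq^{n}$, $\beta_{n+1}=a+b+dq^{n}$. Let $A_N$ and $B_N$ denote its $N$-th numerator and denominator convergents. (i) For $N\ge 1$, \[ A_{N}= \sum_{j,l,n\geq 0}a^{j}b^{N-1-n-j-l}c^{l} d^{n-l}q^{n(n+1)/2+l(l+1)/2} \begin{bmatrix} n+j\\ j \end{bmatrix} \begin{bmatrix} N-1-j-l\\ n \end{bmatrix} \begin{bmatrix} n\\ l \end{bmatrix}, \] and for $N\geq 2$, \[ B_{N}= A_{N}+ (c q-a b) \sum_{j,l,n\geq 0}a^{j}b^{N-2-n-j-l}c^{l} d^{n-l}q^{n(n+3)/2+l(l+1)/2} \begin{bmatrix} n+j\\ j \end{bmatrix} \begin{bmatrix} N-2-j-l\\ n \end{bmatrix} \begin{bmatrix} n\\ l \end{bmatrix}. \] (ii) If $|a/b|<1$ and $|q|<1$, then $H(a,b,c,d,q)$ converges and \[ \frac{1}{H(a,b,c,d,q)}-1= \frac{ (c q/b -a)\displaystyle\sum_{n=0}^{\infty} \frac{(d/b)^{n}q^{n(n+3)/2}(-cq/(db);q)_{n}} {(a/b;q)_{n+1}(q;q)_{n}}}{\displaystyle\sum_{n=0}^{\infty}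 \frac{(d/b)^{n}q^{n(n+1)/2}(-cq/(d b);q)_{n}} {(a/b;q)_{n+1}(q;q)_{n}} }. \] (iii) If $|q|<1$, $|a|<1$ and $b=1$, then the numerators and denominators converge separately and \[ \lim_{N \to \infty} A_{N} = \sum_{n=0}^{\infty} \frac{d^{n}q^{n(n+1)/2}(-cq/d;q)_{n}} {(a;q)_{n+1}(q;q)_{n}}, \] \[ \lim_{N \to \infty} B_{N} = \sum_{n=0}^{\infty} \frac{d^{n}q^{n(n+1)/2}(-cq/d;q)_{n}} {(a;q)_{n+1}(q;q)_{n}} + (c q -a)\sum_{n=0}^{\infty} \frac{d^{n}q^{n(n+3)/2}(-cq/d;q)_{n}} {(a;q)_{n+1}(q;q)_{n}}. \]
   Context: For a continued fraction $\beta_0+\mathrm{K}_{n=1}^{\infty}\alpha_n/\beta_n=\beta_0+\cfrac{\alpha_1}{\beta_1+\cfrac{\alpha_2}{\beta_2+\cdots}}$ (here $\beta_0=0$), the numerator and denominator convergents are defined by $A_{-1}=1$, $A_0=\beta_0$, $B_{-1}=0$, $B_0=1$, and $A_N=\beta_NA_{N-1}+\alpha_NA_{N-2}$, $B_N=\beta_NB_{N-1}+\alpha_NB_{N-2}$ for $N\ge1$; the continued fraction converges if $A_N/B_N$ converges, its value being the limit. Notation: $(x;q)_0=1$, $(x;q)_n=\prod_{k=0}^{n-1}(1-xq^k)$. The Gaussian polynomial $\begin{bmatrix} n\\ m\end{bmatrix}=\frac{(q;q)_n}{(q;q)_m(q;q)_{n-m}}$ if $0\le m\le n$ and $0$ otherwise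 (in particular it is $0$ when $n<0$ or $m>n$). In expressions such as $(d/b)^n(-cq/(db);q)_n$, the combination is understood as the polynomial $\prod_{k=0}^{n-1}(d/b+cq^{k+1}/b^2)$.
   Formalization: In (ii), with E/D the right side, the identity is stated if D and D+E are nonzero; if only D+E=0, A_N/B_N tends to infinity; if D=0≠E, H=0; if D=E=0, only convergence in the Riemann sphere. The case a=c=0, b+dq^k=0 for some k≥1 (where A_N=B_N=0 eventually) is excluded. *)

theory Defs
  imports "HOL-Analysis.Analysis" "HOL-Computational_Algebra.Computational_Algebra"
begin

text \<open>
  The numerators and denominators of a continued fraction start at index \<open>-1\<close>; in
  \<open>cf_num_from\<close> and \<open>cf_den_from\<close> all indices are shifted by one, so that
  \<open>cf_num_from \<alpha> \<beta> k\<close> is \<open>A\<^bsub>k-1\<^esub>\<close> and \<open>cf_den_from \<alpha> \<beta> k\<close> is \<open>B\<^bsub>k-1\<^esub>\<close>.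
  The value \<open>\<alpha> 0\<close> is never used.
\<close>

fun cf_num_from :: "(nat \<Rightarrow> complex) \<Rightarrow> (nat \<Rightarrow> complex) \<Rightarrow> nat \<Rightarrow> complex" where
  "cf_num_from \<alpha> \<beta> 0 = 1"
| "cf_num_from \<alpha> \<beta> (Suc 0) = \<beta> 0"
| "cf_num_from \<alpha> \<beta> (Suc (Suc n)) =
     \<beta> (Suc n) * cf_num_from \<alpha> \<beta> (Suc n) + \<alpha> (Suc n) * cf_num_from \<alpha> \<beta> n"

fun cf_den_from :: "(nat \<Rightarrow> complex) \<Rightarrow> (nat \<Rightarrow> complex) \<Rightarrow> nat \<Rightarrow> complex" where
  "cf_den_from \<alpha> \<beta> 0 = 0"
| "cf_den_from \<alpha> \<beta> (Suc 0) = 1"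
| "cf_den_from \<alpha> \<beta> (Suc (Suc n)) =
     \<beta> (Suc n) * cf_den_from \<alpha> \<beta> (Suc n) + \<alpha> (Suc n) * cf_den_from \<alpha> \<beta> n"

definition cf_num :: "(nat \<Rightarrow> complex) \<Rightarrow> (nat \<Rightarrow> complex) \<Rightarrow> nat \<Rightarrow> complex" where
  "cf_num \<alpha> \<beta> N = cf_num_from \<alpha> \<beta> (Suc N)"

definition cf_den :: "(nat \<Rightarrow> complex) \<Rightarrow> (nat \<Rightarrow> complex) \<Rightarrow> nat \<Rightarrow> complex" where
  "cf_den \<alpha> \<beta> N = cf_den_from \<alpha> \<beta> (Suc N)"

text \<open>
  Since \<open>x / 0 = 0\<close> in HOL, convergence demands explicitly that the quotients \<open>A\<^sub>N / B\<^sub>N\<close>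
  are eventually defined.
\<close>

definition cf_converges :: "(nat \<Rightarrow> complex) \<Rightarrow> (nat \<Rightarrow> complex) \<Rightarrow> bool" where
  "cf_converges \<alpha> \<beta> \<longleftrightarrow>
     (\<forall>\<^sub>F N in sequentially. cf_den \<alpha> \<beta> N \<noteq> 0) \<and>
     convergent (\<lambda>N. cf_num \<alpha> \<beta> N / cf_den \<alpha> \<beta> N)"

definition cf_value :: "(nat \<Rightarrow> complex) \<Rightarrow> (nat \<Rightarrow> complex) \<Rightarrow> complex" where
  "cf_value \<alpha> \<beta> = lim (\<lambda>N. cf_num \<alpha> \<beta> N / cf_den \<alpha> \<beta> N)"

text \<open>
  Convergence of \<open>A\<^sub>N / B\<^sub>N\<close> to the point \<open>\<infinity>\<close> of the Riemann sphere. It is stated for the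
  reciprocals because \<open>B\<^sub>N = 0 \<noteq> A\<^sub>N\<close>, i.e. \<open>A\<^sub>N / B\<^sub>N = \<infinity>\<close>, may occur for infinitely many \<open>N\<close>.
\<close>

definition cf_tends_to_infinity :: "(nat \<Rightarrow> complex) \<Rightarrow> (nat \<Rightarrow> complex) \<Rightarrow> bool" where
  "cf_tends_to_infinity \<alpha> \<beta> \<longleftrightarrow>
     (\<forall>\<^sub>F N in sequentially. cf_num \<alpha> \<beta> N \<noteq> 0) \<and>
     (\<lambda>N. cf_den \<alpha> \<beta> N / cf_num \<alpha> \<beta> N) \<longlonglongrightarrow> 0"

definition qpoch :: "'a::comm_ring_1 \<Rightarrow> 'a \<Rightarrow> nat \<Rightarrow> 'a" where
  "qpoch x q n = (\<Prod>k<n. 1 - x * q ^ k)"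

text \<open>
  The quotient of the products \<open>(q;q)\<^sub>n\<close> is formed in the polynomial ring, with \<open>q\<close> the
  indeterminate \<open>[:0, 1:]\<close>, where the division is exact, and is then evaluated at the complex
  number \<open>q\<close>. In this way it also has its correct value when \<open>q\<close> is a root of unity.
\<close>

definition gauss_poly :: "nat \<Rightarrow> nat \<Rightarrow> complex poly" where
  "gauss_poly n m =
     qpoch [:0, 1:] [:0, 1:] n div
       (qpoch [:0, 1:] [:0, 1:] m * qpoch [:0, 1:] [:0, 1:] (n - m))"

definition gauss_binomial :: "complex \<Rightarrow> int \<Rightarrow> int \<Rightarrow> complex" where
  "gauss_binomial q n m =
     (if 0 \<le> m \<and> m \<le> n then poly (gauss_poly (nat n) (nat m)) q else 0)"

definition H_alpha :: "complex \<Rightarrow> complex \<Rightarrow> complex \<Rightarrow> complex \<Rightarrow> complex \<Rightarrow> nat \<Rightarrow> complex" where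
  "H_alpha a b c d q n = (if n \<le> 1 then 1 else - a * b + c * q ^ (n - 1))"

definition H_beta :: "complex \<Rightarrow> complex \<Rightarrow> complex \<Rightarrow> complex \<Rightarrow> complex \<Rightarrow> nat \<Rightarrow> complex" where
  "H_beta a b c d q n =
     (if n = 0 then 0 else if n = 1 then 1 else a + b + d * q ^ (n - 1))"

definition H_num :: "complex \<Rightarrow> complex \<Rightarrow> complex \<Rightarrow> complex \<Rightarrow> complex \<Rightarrow> nat \<Rightarrow> complex" where
  "H_num a b c d q = cf_num (H_alpha a b c d q) (H_beta a b c d q)"

definition H_den :: "complex \<Rightarrow> complex \<Rightarrow> complex \<Rightarrow> complex \<Rightarrow> complex \<Rightarrow> nat \<Rightarrow> complex" where
  "H_den a b c d q = cf_den (H_alpha a b c d q) (H_beta a b c d q)"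

definition H_converges :: "complex \<Rightarrow> complex \<Rightarrow> complex \<Rightarrow> complex \<Rightarrow> complex \<Rightarrow> bool" where
  "H_converges a b c d q = cf_converges (H_alpha a b c d q) (H_beta a b c d q)"

definition H_tends_to_infinity :: "complex \<Rightarrow> complex \<Rightarrow> complex \<Rightarrow> complex \<Rightarrow> complex \<Rightarrow> bool" where
  "H_tends_to_infinity a b c d q = cf_tends_to_infinity (H_alpha a b c d q) (H_beta a b c d q)"

definition H_value :: "complex \<Rightarrow> complex \<Rightarrow> complex \<Rightarrow> complex \<Rightarrow> complex \<Rightarrow> complex" where
  "H_value a b c d q = cf_value (H_alpha a b c d q) (H_beta a b c d q)"

text \<open>
  With \<open>e = 1\<close> and \<open>e = 3\<close> these are the terms
  \<open>(d/b)\<^sup>n q\<^bsup>n(n+e)/2\<^esup> (-cq/(db);q)\<^sub>n / ((a/b;q)\<^bsub>n+1\<^esub> (q;q)\<^sub>n)\<close> of the two series, where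
  \<open>(d/b)\<^sup>n (-cq/(db);q)\<^sub>n\<close> denotes the product below, also for \<open>d = 0\<close>.
\<close>

definition H_term ::
    "nat \<Rightarrow> complex \<Rightarrow> complex \<Rightarrow> complex \<Rightarrow> complex \<Rightarrow> complex \<Rightarrow> nat \<Rightarrow> complex" where
  "H_term e a b c d q n =
     (\<Prod>k<n. d / b + c * q ^ (k + 1) / b ^ 2) * q ^ (n * (n + e) div 2) /
       (qpoch (a / b) q (n + 1) * qpoch q q n)"

end

theory Submission
  imports Defs
begin

text \<open>
  For the explicit formulas, \<open>F(t) = \<Sum> A\<^bsub>N+1\<^esub> t\<^sup>N\<close> satisfies
  \<open>(1 - at)(1 - bt) F(t) = 1 + (dqt + cq\<^sup>2t\<^sup>2) F(qt)\<close>. Iterating this equation writes \<open>F\<close> as a sum of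
  products, which the \<open>q\<close>-binomial theorems expand. The denominators reduce to the numerators by
  \<open>B\<^sub>N = A\<^sub>N + (cq - ab) A\<^bsub>N-1\<^esub>(a, b, cq, dq)\<close>.

  For the limits one may scale to \<open>b = 1\<close>. Let \<open>D(z) = \<Sum> e\<^sub>n z\<^sup>n\<close> where \<open>e\<^sub>n\<close> are the terms of the first
  series; the second series is \<open>D(q)\<close>. The term ratio \<open>e\<^bsub>n+1\<^esub> / e\<^sub>n\<close> gives
  \<open>D(z) = (1 + a + dqz) D(qz) + (cq\<^sup>2z - a) D(q\<^sup>2z)\<close>, which is adjoint to the recurrence of the
  convergents: for every solution \<open>x\<close> the quantity
  \<open>x\<^bsub>n+1\<^esub> D(q\<^sup>n) + (cq\<^bsup>n+1\<^esup> - a) x\<^sub>n D(q\<^bsup>n+1\<^esup>)\<close> does not depend on \<open>n\<close>. Since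
  \<open>D(q\<^sup>n) \<longlonglongrightarrow> 1/(1 - a)\<close> and \<open>|a| < 1\<close>, it is the limit of \<open>x\<^sub>n\<close>.
\<close>

text \<open>This frees \<open>$\<close> for the coefficients of formal power series.\<close>

unbundle no vec_syntax

subsection \<open>Gaussian binomials\<close>

lemma qpoch_Suc: "qpoch x q (Suc n) = qpoch x q n * (1 - x * q ^ n)"
  by (simp add: qpoch_def)

lemma qpoch_0 [simp]: "qpoch x q 0 = 1"
  by (simp add: qpoch_def)

text \<open>The \<open>q\<close>-Pascal rule shows that the division in the definition of the Gaussian polynomial is exact.\<close>

fun gauss_poly_rec :: "nat \<Rightarrow> nat \<Rightarrow> complex poly" where
  "gauss_poly_rec n 0 = 1"
| "gauss_poly_rec 0 (Suc m) = 0"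
| "gauss_poly_rec (Suc n) (Suc m) =
     gauss_poly_rec n m + [:0, 1:] ^ Suc m * gauss_poly_rec n (Suc m)"

lemma gauss_poly_rec_eq_0: "n < m \<Longrightarrow> gauss_poly_rec n m = 0"
  by (induction n m rule: gauss_poly_rec.induct) auto

text \<open>The two summands of the Pascal rule contribute \<open>1 - X^(m+1)\<close> and
  \<open>X^(m+1) * (1 - X^(n-m))\<close>, whose sum is the new factor
  \<open>1 - X^(n+1)\<close>.\<close>

lemma gauss_poly_rec_mult_qpoch:
  "m \<le> n \<Longrightarrow> gauss_poly_rec n m * (qpoch [:0, 1:] [:0, 1:] m * qpoch [:0, 1:] [:0, 1:] (n - m))
     = qpoch [:0, 1:] [:0, 1:] n"
proof (induction n m rule: gauss_poly_rec.induct)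
  case (3 n m)
  let ?X = "[:0, 1:] :: complex poly"
  let ?Q = "qpoch ?X ?X"
  have 1: "gauss_poly_rec n m * (?Q m * ?Q (n - m)) = ?Q n"
    using 3 by simp
  \<comment> \<open>For \<open>m = n\<close> the induction hypothesis does not apply, but both sides
    are zero.\<close>
  have 2: "gauss_poly_rec n (Suc m) * (?Q (Suc m) * ?Q (n - m)) = ?Q n * (1 - ?X ^ (n - m))"
  proof (cases "m = n")
    case False
    then obtain k where k: "n - m = Suc k" "n - Suc m = k"
      using 3 by (metis Suc_diff_Suc Suc_le_mono le_neq_implies_less)
    have "gauss_poly_rec n (Suc m) * (?Q (Suc m) * ?Q k) = ?Q n"
      using 3 False k by simp
    moreover have "?Q (Suc k) = ?Q k * (1 - ?X ^ Suc k)"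
      by (simp only: qpoch_Suc power_Suc)
    ultimately show ?thesis
      unfolding k(1) by (simp only: mult.assoc [symmetric])
  qed (simp add: gauss_poly_rec_eq_0)
  have Q: "?Q (Suc j) = ?Q j * (1 - ?X ^ Suc j)" for j
    by (simp only: qpoch_Suc power_Suc)
  have "gauss_poly_rec (Suc n) (Suc m) * (?Q (Suc m) * ?Q (n - m)) =
      gauss_poly_rec n m * (?Q m * ?Q (n - m)) * (1 - ?X ^ Suc m)
        + ?X ^ Suc m * (gauss_poly_rec n (Suc m) * (?Q (Suc m) * ?Q (n - m)))"
    unfolding gauss_poly_rec.simps Q by (simp only: algebra_simps)
  also have "\<dots> = ?Q n * (1 - ?X ^ Suc m * ?X ^ (n - m))"
    unfolding 1 2 by (simp only: algebra_simps mult_1)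
  also have "\<dots> = ?Q (Suc n)"
    using 3 unfolding Q power_add [symmetric] by simp
  finally show ?case by simp
qed auto

lemma qpoch_X_nonzero: "qpoch [:0, 1:] [:0, 1:] n \<noteq> (0 :: complex poly)"
proof -
  have "poly (qpoch [:0, 1:] [:0, 1:] n) (0 :: complex) = 1"
    by (simp add: qpoch_def poly_prod)
  then show ?thesis by force
qed

lemma gauss_poly_eq_rec: "m \<le> n \<Longrightarrow> gauss_poly n m = gauss_poly_rec n m"
  unfolding gauss_poly_def gauss_poly_rec_mult_qpoch [symmetric]
  by (rule nonzero_mult_div_cancel_right) (simp add: qpoch_X_nonzero)

text \<open>Based on the recursion, so that the Pascal rule holds for all natural arguments, with
  value 0 for \<open>n < m\<close>.\<close>

definition gbin :: "complex \<Rightarrow> nat \<Rightarrow> nat \<Rightarrow> complex" where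
  "gbin q n m = poly (gauss_poly_rec n m) q"

lemma gauss_binomial_of_nat: "gauss_binomial q (int n) (int m) = gbin q n m"
  by (simp add: gauss_binomial_def gbin_def gauss_poly_eq_rec gauss_poly_rec_eq_0)

lemma gbin_0_right [simp]: "gbin q n 0 = 1"
  by (cases n) (auto simp: gbin_def)

lemma gbin_eq_0: "n < m \<Longrightarrow> gbin q n m = 0"
  by (simp add: gbin_def gauss_poly_rec_eq_0)

lemma gbin_Suc_Suc: "gbin q (Suc n) (Suc m) = gbin q n m + q ^ Suc m * gbin q n (Suc m)"
  by (simp add: gbin_def)

text \<open>Symmetry is visible in the quotient form, not in the recursion.\<close>

lemma gbin_symmetric: "m \<le> n \<Longrightarrow> gbin q n (n - m) = gbin q n m"
  by (simp add: gbin_def gauss_poly_def mult.commute flip: gauss_poly_eq_rec)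

subsection \<open>Generating function of the numerators\<close>

text \<open>This composition is the substitution of qt for t.\<close>

lemma fps_compose_linear_nth:
  fixes f :: "complex fps"
  shows "(f oo (fps_const q * fps_X)) $ n = q ^ n * f $ n"
  by (simp add: fps_compose_nth power_mult_distrib fps_const_power fps_X_power_iff
      if_distrib [of "\<lambda>x. _ * x"] sum.delta' cong: if_cong)

text \<open>In the following definitions \<open>t\<close> is the formal variable: \<open>qgeom q x n\<close> is \<open>1 / (xt;q)\<^bsub>n+1\<^esub>\<close>,
  \<open>qbin q c d n\<close> is \<open>\<Prod>\<^bsub>k=1..n\<^esub> (d + c q\<^sup>k t)\<close>, and \<open>Hgen a b c d q n\<close> is
  \<open>(\<Prod>\<^bsub>k=1..n\<^esub> (d q\<^sup>k t + c q\<^bsup>2k\<^esup> t\<^sup>2)) / ((at;q)\<^bsub>n+1\<^esub> (bt;q)\<^bsub>n+1\<^esub>)\<close>.\<close>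

definition qgeom :: "complex \<Rightarrow> complex \<Rightarrow> nat \<Rightarrow> complex fps" where
  "qgeom q x n = Abs_fps (\<lambda>j. gbin q (n + j) j * x ^ j)"

definition qbin :: "complex \<Rightarrow> complex \<Rightarrow> complex \<Rightarrow> nat \<Rightarrow> complex fps" where
  "qbin q c d n = Abs_fps (\<lambda>l. gbin q n l * q ^ (l * (l + 1) div 2) * c ^ l * d ^ (n - l))"

definition Hgen :: "complex \<Rightarrow> complex \<Rightarrow> complex \<Rightarrow> complex \<Rightarrow> complex \<Rightarrow> nat \<Rightarrow> complex fps" where
  "Hgen a b c d q n = fps_const (q ^ (n * (n + 1) div 2)) * (fps_X ^ n *
     (qbin q c d n * (qgeom q a n * qgeom q b n)))"

lemma one_minus_fps_X_mult_nth:
  fixes f :: "complex fps"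
  shows "((1 - fps_const x * fps_X) * f) $ n = f $ n - (if n = 0 then 0 else x * f $ (n - 1))"
  by (simp add: algebra_simps)

lemma gbin_self: "gbin q n n = 1"
  by (induction n) (auto simp: gbin_Suc_Suc gbin_eq_0)

lemma qgeom_0: "(1 - fps_const x * fps_X) * qgeom q x 0 = 1"
  by (rule fps_ext) (auto simp: one_minus_fps_X_mult_nth qgeom_def gbin_self gr0_conv_Suc
      simp flip: power_Suc)

text \<open>Cancelling the first factor of (xt;q) leaves the shorter product at qt; on coefficients
  this is the Pascal rule.\<close>

lemma qgeom_Suc:
  "(1 - fps_const x * fps_X) * qgeom q x (Suc n) = qgeom q x n oo (fps_const q * fps_X)"
proof (rule fps_ext)
  fix j
  show "((1 - fps_const x * fps_X) * qgeom q x (Suc n)) $ j = (qgeom q x n oo (fps_const q * fps_X)) $ j"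
    unfolding one_minus_fps_X_mult_nth fps_compose_linear_nth
    by (cases j) (simp_all add: qgeom_def gbin_Suc_Suc algebra_simps)
qed

lemma triangle_Suc: "Suc n * (Suc n + 1) div 2 = n * (n + 1) div 2 + Suc n"
  by simp

text \<open>The factor with k = 1 splits off and the others form the shorter product at qt; on
  coefficients this is again the Pascal rule.\<close>

lemma qbin_Suc:
  "qbin q c d (Suc n) = (fps_const d + fps_const (c * q) * fps_X) * (qbin q c d n oo (fps_const q * fps_X))"
proof (rule fps_ext)
  fix l
  have R: "((fps_const d + fps_const (c * q) * fps_X) * f) $ l =
      d * f $ l + (if l = 0 then 0 else c * q * f $ (l - 1))" for f :: "complex fps"
    by (simp add: algebra_simps)
  show "qbin q c d (Suc n) $ l =
    ((fps_const d + fps_const (c * q) * fps_X) * (qbin q c d n oo (fps_const q * fps_X))) $ l"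
  proof (cases l)
    case 0
    then show ?thesis unfolding R by (simp add: qbin_def fps_compose_linear_nth)
  next
    case (Suc k)
    \<comment> \<open>For \<open>k >= n\<close> the exponent \<open>n - Suc k\<close> is truncated,
      but then the Gaussian binomial is zero.\<close>
    have d: "gbin q n (Suc k) * d ^ (n - k) = d * (gbin q n (Suc k) * d ^ (n - Suc k))"
      by (cases "k < n") (auto simp: gbin_eq_0 Suc_diff_Suc simp flip: power_Suc)
    have "qbin q c d (Suc n) $ l = q ^ (k * (k + 1) div 2) * q ^ Suc k * c ^ Suc k *
        (gbin q n k * d ^ (n - k) + q ^ Suc k * (gbin q n (Suc k) * d ^ (n - k)))"
      unfolding Suc qbin_def fps_nth_Abs_fps triangle_Suc gbin_Suc_Suc power_add
      by (simp add: algebra_simps)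
    also have "\<dots> = d * (qbin q c d n oo (fps_const q * fps_X)) $ Suc k
        + c * q * (qbin q c d n oo (fps_const q * fps_X)) $ k"
      unfolding d
      unfolding qbin_def fps_compose_linear_nth fps_nth_Abs_fps triangle_Suc power_add
      by (simp add: algebra_simps)
    finally show ?thesis unfolding R unfolding Suc by simp
  qed
qed

lemma Hgen_0: "(1 - fps_const a * fps_X) * (1 - fps_const b * fps_X) * Hgen a b c d q 0 = 1"
proof -
  have "qbin q c d 0 = 1"
    by (rule fps_ext) (auto simp: qbin_def gbin_eq_0)
  then have "(1 - fps_const a * fps_X) * (1 - fps_const b * fps_X) * Hgen a b c d q 0 =
    ((1 - fps_const a * fps_X) * qgeom q a 0) * ((1 - fps_const b * fps_X) * qgeom q b 0)"
    by (simp add: Hgen_def mult_ac)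
  then show ?thesis by (simp add: qgeom_0)
qed

text \<open>Splitting off the first factors leaves the preceding term at qt. Together with
  \<open>Hgen_0\<close>, summation over n gives the functional equation of F.\<close>

lemma Hgen_Suc:
  "(1 - fps_const a * fps_X) * (1 - fps_const b * fps_X) * Hgen a b c d q (Suc n) =
     (fps_const (d * q) * fps_X + fps_const (c * q\<^sup>2) * fps_X\<^sup>2) *
       (Hgen a b c d q n oo (fps_const q * fps_X))"
proof -
  let ?s = "\<lambda>f. f oo (fps_const q * fps_X)"
  have s: "?s (Hgen a b c d q n) = fps_const (q ^ (n * (n + 1) div 2)) *
      (fps_const (q ^ n) * fps_X ^ n * (?s (qbin q c d n) * (?s (qgeom q a n) * ?s (qgeom q b n))))"
    unfolding Hgen_def
    by (simp add: fps_compose_mult_distrib fps_compose_power [symmetric] power_mult_distrib fps_const_power)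
  have "(1 - fps_const a * fps_X) * (1 - fps_const b * fps_X) * Hgen a b c d q (Suc n) =
     fps_const (q ^ (n * (n + 1) div 2) * q ^ Suc n) * (fps_X ^ Suc n * (qbin q c d (Suc n) *
      (((1 - fps_const a * fps_X) * qgeom q a (Suc n)) * ((1 - fps_const b * fps_X) * qgeom q b (Suc n)))))"
    unfolding Hgen_def triangle_Suc power_add by (simp only: mult_ac)
  also have "\<dots> = fps_const (q ^ (n * (n + 1) div 2) * q ^ Suc n) * (fps_X ^ Suc n *
      ((fps_const d + fps_const (c * q) * fps_X) * ?s (qbin q c d n) *
      (?s (qgeom q a n) * ?s (qgeom q b n))))"
    unfolding qgeom_Suc qbin_Suc ..
  also have "\<dots> = (fps_const (d * q) * fps_X + fps_const (c * q\<^sup>2) * fps_X\<^sup>2) * ?s (Hgen a b c d q n)"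
  proof -
    have "(K * (Q * Y)) * ((X * Z) * ((D + (C * Q) * X) * W * (U * V))) =
        ((D * Q) * X + (C * (Q * Q)) * (X * X)) * (K * (Y * Z * (W * (U * V))))"
      for K Q Y X Z D C W U V :: "complex fps"
      by (simp add: algebra_simps)
    then show ?thesis
      unfolding s power_Suc power2_eq_square fps_const_mult [symmetric] by blast
  qed
  finally show ?thesis .
qed

lemma quadratic_mult_nth:
  fixes f :: "complex fps"
  shows "((1 - fps_const a * fps_X) * (1 - fps_const b * fps_X) * f) $ Suc (Suc N) =
    f $ Suc (Suc N) - (a + b) * f $ Suc N + a * b * f $ N"
  unfolding mult.assoc one_minus_fps_X_mult_nth by (simp add: algebra_simps)

lemma Hgen_Suc_nth:
  "Hgen a b c d q (Suc n) $ Suc (Suc N) =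
     (a + b) * Hgen a b c d q (Suc n) $ Suc N - a * b * Hgen a b c d q (Suc n) $ N +
     (d * q ^ Suc (Suc N) * Hgen a b c d q n $ Suc N + c * q ^ Suc (Suc N) * Hgen a b c d q n $ N)"
proof -
  have R: "((fps_const (d * q) * fps_X + fps_const (c * q\<^sup>2) * fps_X\<^sup>2) * f) $ Suc (Suc N)
      = d * q * f $ Suc N + c * q\<^sup>2 * f $ N" for f :: "complex fps"
    by (simp add: distrib_right mult.assoc fps_X_power_mult_nth)
  have "((fps_const (d * q) * fps_X + fps_const (c * q\<^sup>2) * fps_X\<^sup>2) *
       (Hgen a b c d q n oo (fps_const q * fps_X))) $ Suc (Suc N) =
     d * q ^ Suc (Suc N) * Hgen a b c d q n $ Suc N + c * q ^ Suc (Suc N) * Hgen a b c d q n $ N"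
    unfolding R fps_compose_linear_nth by (simp add: power2_eq_square mult_ac)
  then show ?thesis
    using quadratic_mult_nth [of a b "Hgen a b c d q (Suc n)" N] unfolding Hgen_Suc
    by (simp add: algebra_simps)
qed

lemma Hgen_0_nth:
  "Hgen a b c d q 0 $ Suc (Suc N) = (a + b) * Hgen a b c d q 0 $ Suc N - a * b * Hgen a b c d q 0 $ N"
  using quadratic_mult_nth [of a b "Hgen a b c d q 0" N] unfolding Hgen_0 by (simp add: algebra_simps)

lemma Hgen_nth_eq_0: "N < n \<Longrightarrow> Hgen a b c d q n $ N = 0"
  by (simp add: Hgen_def fps_X_power_mult_nth)

lemma H_num_0: "H_num a b c d q 0 = 0"
  by (simp add: H_num_def cf_num_def H_beta_def)

lemma H_num_1: "H_num a b c d q (Suc 0) = 1"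
  by (simp add: H_num_def cf_num_def H_beta_def H_alpha_def)

lemma H_num_Suc_Suc: "H_num a b c d q (Suc (Suc n)) =
    (a + b + d * q ^ Suc n) * H_num a b c d q (Suc n) + (- a * b + c * q ^ Suc n) * H_num a b c d q n"
  by (simp add: H_num_def cf_num_def H_beta_def H_alpha_def)

lemma H_den_0: "H_den a b c d q 0 = 1"
  by (simp add: H_den_def cf_den_def H_beta_def)

lemma H_den_1: "H_den a b c d q (Suc 0) = 1"
  by (simp add: H_den_def cf_den_def H_beta_def H_alpha_def)

lemma H_den_Suc_Suc: "H_den a b c d q (Suc (Suc n)) =
    (a + b + d * q ^ Suc n) * H_den a b c d q (Suc n) + (- a * b + c * q ^ Suc n) * H_den a b c d q n"
  by (simp add: H_den_def cf_den_def H_beta_def H_alpha_def)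

text \<open>Comparing coefficients in the functional equation gives the recurrence of the
  numerators. The bound \<open>M\<close> is left free because splitting off the term n = 0 lowers it
  by one; terms with \<open>n > N\<close> do not contribute.\<close>

lemma H_num_eq_sum_Hgen: "M \<ge> N \<Longrightarrow> H_num a b c d q (Suc N) = (\<Sum>n\<le>M. Hgen a b c d q n $ N)"
proof (induction N arbitrary: M rule: induct_nat_012)
  case 0
  have "(\<Sum>n\<le>M. Hgen a b c d q n $ 0) = Hgen a b c d q 0 $ 0"
    by (subst sum.mono_neutral_right [of _ "{0}"]) (auto simp: Hgen_nth_eq_0)
  then show ?case
    by (simp add: H_num_1 Hgen_def qbin_def qgeom_def)
next
  case 1
  have "(\<Sum>n\<le>M. Hgen a b c d q n $ 1) = (\<Sum>n\<le>Suc 0. Hgen a b c d q n $ 1)"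
    using 1 by (intro sum.mono_neutral_right) (auto simp: Hgen_nth_eq_0)
  also have "\<dots> = a + b + d * q"
    by (simp add: Hgen_def qbin_def qgeom_def fps_mult_nth gbin_eq_0 gbin_self)
  finally show ?case
    by (simp add: H_num_Suc_Suc H_num_0 H_num_1)
next
  case (ge2 N)
  then obtain M' where M: "M = Suc M'" by (cases M) auto
  let ?G = "Hgen a b c d q"
  have split: "(\<Sum>n\<le>M. f n) = f 0 + (\<Sum>n\<le>M'. f (Suc n))" for f :: "nat \<Rightarrow> complex"
    unfolding M by (rule sum.atMost_Suc_shift)
  have "(\<Sum>n\<le>M. ?G n $ Suc (Suc N)) = (a + b) * (\<Sum>n\<le>M. ?G n $ Suc N) - a * b * (\<Sum>n\<le>M. ?G n $ N)
      + (d * q ^ Suc (Suc N) * (\<Sum>n\<le>M'. ?G n $ Suc N) + c * q ^ Suc (Suc N) * (\<Sum>n\<le>M'. ?G n $ N))"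
    unfolding split Hgen_Suc_nth Hgen_0_nth
    by (simp add: sum.distrib sum_subtractf sum_distrib_left algebra_simps)
  also have "\<dots> = (a + b) * H_num a b c d q (Suc (Suc N)) - a * b * H_num a b c d q (Suc N)
      + (d * q ^ Suc (Suc N) * H_num a b c d q (Suc (Suc N)) + c * q ^ Suc (Suc N) * H_num a b c d q (Suc N))"
    using ge2.IH(1)[of M] ge2.IH(1)[of M'] ge2.IH(2)[of M] ge2.IH(2)[of M'] ge2.prems M by auto
  finally show ?case
    unfolding H_num_Suc_Suc [of _ _ _ _ _ "Suc N"] by (simp add: algebra_simps)
qed

subsection \<open>The series and their functional equation\<close>

lemma norm_mult_power_less_1:
  fixes x q :: complex
  assumes "cmod x < 1" "cmod q < 1"
  shows "cmod (x * q ^ k) < 1"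
proof -
  have "cmod (x * q ^ k) \<le> cmod x"
    using assms by (simp add: norm_mult norm_power mult_left_le power_le_one)
  then show ?thesis using assms by simp
qed

lemma one_minus_mult_power_nonzero:
  fixes x q :: complex
  assumes "cmod x < 1" "cmod q < 1"
  shows "1 - x * q ^ k \<noteq> 0"
  using norm_mult_power_less_1 [OF assms, of k] by auto

lemma qpoch_nonzero:
  fixes x q :: complex
  assumes "cmod x < 1" "cmod q < 1"
  shows "qpoch x q n \<noteq> 0"
  using one_minus_mult_power_nonzero [OF assms] by (simp add: qpoch_def)

lemma H_term_3: "H_term 3 a b c d q n = H_term 1 a b c d q n * q ^ n"
proof -
  have "n * (n + 3) div 2 = n * (n + 1) div 2 + n"
    by (simp add: algebra_simps)
  then show ?thesis
    by (simp add: H_term_def power_add)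
qed

lemma H_term_scale:
  "H_term e a b c d q = H_term e (a / b) 1 (c / b\<^sup>2) (d / b) q"
  by (rule ext) (simp add: H_term_def)

lemma H_term_Suc:
  assumes "cmod a < 1" "cmod q < 1"
  shows "H_term 1 a 1 c d q (Suc n) * ((1 - a * q ^ Suc n) * (1 - q ^ Suc n)) =
    q ^ Suc n * (d + c * q ^ Suc n) * H_term 1 a 1 c d q n"
proof -
  have "1 - a * q ^ Suc n \<noteq> 0" "1 - q * q ^ n \<noteq> 0"
    using one_minus_mult_power_nonzero assms by blast+
  moreover have "qpoch a q (Suc n) \<noteq> 0" "qpoch q q n \<noteq> 0"
    using qpoch_nonzero assms by blast+
  \<comment> \<open>Here \<open>u\<close> and \<open>v\<close> are the new factors of the two
    q-products in the denominator, \<open>x\<close> and \<open>y\<close> the new factors of the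
    numerator.\<close>
  moreover have "(P * x) * (Q * y) / ((A * u) * (B * v)) * (u * v) = y * x * (P * Q / (A * B))"
    if "u \<noteq> 0" "v \<noteq> 0" for P Q A B x y u v :: complex
    using that by simp
  moreover have H: "H_term 1 a 1 c d q m = (\<Prod>k<m. d + c * q ^ Suc k) * q ^ (m * (m + 1) div 2)
      / (qpoch a q (Suc m) * qpoch q q m)" for m
    by (simp add: H_term_def)
  ultimately show ?thesis
    unfolding H triangle_Suc power_add prod.lessThan_Suc qpoch_Suc [of a q "Suc n"] qpoch_Suc [of q q n]
      power_Suc
    by blast
qed

text \<open>The term ratio tends to 0 through its factor \<open>q ^ Suc n\<close>, so the power
  series converges for every \<open>z\<close>.\<close>

lemma summable_H_term:
  assumes "cmod a < 1" "cmod q < 1"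
  shows "summable (\<lambda>n. H_term 1 a 1 c d q n * z ^ n)"
proof -
  define r where "r = (\<lambda>n. q ^ Suc n * (d + c * q ^ Suc n) * z / ((1 - a * q ^ Suc n) * (1 - q ^ Suc n)))"
  have "r \<longlonglongrightarrow> 0 * (d + c * 0) * z / ((1 - a * 0) * (1 - 0))"
    unfolding r_def using assms by (intro tendsto_intros LIMSEQ_Suc LIMSEQ_power_zero) auto
  then have "\<forall>\<^sub>F n in sequentially. dist (r n) 0 < 1 / 2"
    by (intro tendstoD) auto
  then obtain M where M: "\<And>n. n \<ge> M \<Longrightarrow> cmod (r n) < 1 / 2"
    by (auto simp: eventually_sequentially)
  have step: "H_term 1 a 1 c d q (Suc n) * z ^ Suc n = r n * (H_term 1 a 1 c d q n * z ^ n)" for n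
  proof -
    have "(1 - a * q ^ Suc n) * (1 - q * q ^ n) \<noteq> 0"
      using one_minus_mult_power_nonzero assms by (metis mult_eq_0_iff)
    then have "H_term 1 a 1 c d q (Suc n) =
        q ^ Suc n * (d + c * q ^ Suc n) * H_term 1 a 1 c d q n / ((1 - a * q ^ Suc n) * (1 - q ^ Suc n))"
      using H_term_Suc [OF assms, of c d n] by (simp add: eq_divide_eq)
    then show ?thesis by (simp add: r_def)
  qed
  show ?thesis
  proof (rule summable_ratio_test [of "1 / 2" M])
    fix n assume "n \<ge> M"
    then show "cmod (H_term 1 a 1 c d q (Suc n) * z ^ Suc n) \<le> 1 / 2 * cmod (H_term 1 a 1 c d q n * z ^ n)"
      unfolding step norm_mult [of "r n"] using M by (intro mult_right_mono) (auto intro: less_imp_le)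
  qed simp
qed

text \<open>The function D(z) of the introduction, after scaling to \<open>b = 1\<close>.\<close>

definition Hser :: "complex \<Rightarrow> complex \<Rightarrow> complex \<Rightarrow> complex \<Rightarrow> complex \<Rightarrow> complex" where
  "Hser a c d q z = (\<Sum>n. H_term 1 a 1 c d q n * z ^ n)"

lemma Hser_functional_equation:
  assumes "cmod a < 1" "cmod q < 1"
  shows "Hser a c d q z = (1 + a + d * q * z) * Hser a c d q (q * z)
    + (- a + c * q\<^sup>2 * z) * Hser a c d q (q\<^sup>2 * z)"
proof -
  let ?e = "H_term 1 a 1 c d q"
  have sums: "(\<lambda>n. ?e n * w ^ n) sums Hser a c d q w" for w
    unfolding Hser_def using summable_H_term [OF assms] by (rule summable_sums)
  \<comment> \<open>\<open>f\<close> expands \<open>(1 - a * q^n) * (1 - q^n)\<close> times the nth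
    term, each power of \<open>q^n\<close> being absorbed into the argument; \<open>g\<close> does
    the same for the other side of the term ratio.\<close>
  define f where "f = (\<lambda>n. ?e n * z ^ n - (1 + a) * (?e n * (q * z) ^ n) + a * (?e n * (q\<^sup>2 * z) ^ n))"
  define g where "g = (\<lambda>n. d * q * z * (?e n * (q * z) ^ n) + c * q\<^sup>2 * z * (?e n * (q\<^sup>2 * z) ^ n))"
  have f: "f sums (Hser a c d q z - (1 + a) * Hser a c d q (q * z) + a * Hser a c d q (q\<^sup>2 * z))"
    unfolding f_def by (intro sums_add sums_diff sums_mult sums)
  have g: "g sums (d * q * z * Hser a c d q (q * z) + c * q\<^sup>2 * z * Hser a c d q (q\<^sup>2 * z))"
    unfolding g_def by (intro sums_add sums_mult sums)
  have "(\<lambda>n. f (Suc n)) = g"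
  proof
    fix n
    have "f (Suc n) = ?e (Suc n) * ((1 - a * q ^ Suc n) * (1 - q ^ Suc n)) * z ^ Suc n"
      unfolding f_def by (simp add: power_mult_distrib algebra_simps power2_eq_square)
    also have "\<dots> = g n"
      unfolding H_term_Suc [OF assms] g_def
      by (simp add: power_mult_distrib algebra_simps power2_eq_square)
    finally show "f (Suc n) = g n" .
  qed
  \<comment> \<open>The factor \<open>1 - q^n\<close> vanishes at n = 0, so the index shift loses
    nothing.\<close>
  moreover have "f 0 = 0"
    by (simp add: f_def algebra_simps)
  ultimately have "f sums (d * q * z * Hser a c d q (q * z) + c * q\<^sup>2 * z * Hser a c d q (q\<^sup>2 * z))"
    using g sums_Suc_iff [of f] by simp
  from sums_unique2 [OF f this] show ?thesis
    by (simp add: algebra_simps)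
qed

text \<open>D is continuous at 0, and its constant term is 1/(1 - a).\<close>

lemma Hser_power_tendsto:
  assumes "cmod a < 1" "cmod q < 1"
  shows "(\<lambda>n. Hser a c d q (q ^ n)) \<longlonglongrightarrow> 1 / (1 - a)"
proof -
  have "isCont (\<lambda>z. \<Sum>n. H_term 1 a 1 c d q n * z ^ n) 0"
    using isCont_powser_converges_everywhere summable_H_term [OF assms] by blast
  then have "isCont (Hser a c d q) 0"
    by (simp add: Hser_def [abs_def])
  then have "(\<lambda>n. Hser a c d q (q ^ n)) \<longlonglongrightarrow> Hser a c d q 0"
    using assms by (intro isCont_tendsto_compose [of 0 "Hser a c d q"] LIMSEQ_power_zero)
  moreover have "Hser a c d q 0 = 1 / (1 - a)"
    unfolding Hser_def powser_zero by (simp add: H_term_def qpoch_def)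
  ultimately show ?thesis by simp
qed

subsection \<open>Limits of solutions of the recurrence\<close>

text \<open>The common recurrence of numerators and denominators after division by
  \<open>b ^ n\<close>.\<close>

definition Hrec :: "complex \<Rightarrow> complex \<Rightarrow> complex \<Rightarrow> complex \<Rightarrow> (nat \<Rightarrow> complex) \<Rightarrow> bool" where
  "Hrec a c d q x \<longleftrightarrow>
     (\<forall>n. x (Suc (Suc n)) = (1 + a + d * q ^ Suc n) * x (Suc n) + (- a + c * q ^ Suc n) * x n)"

text \<open>The values \<open>Hser a c d q (q\<^sup>n)\<close> solve the adjoint recurrence, so pairing them with a solution gives a
  first integral.\<close>

lemma Hrec_invariant:
  assumes "cmod a < 1" "cmod q < 1" "Hrec a c d q x"
  shows "x (Suc n) * Hser a c d q (q ^ n) + (- a + c * q ^ Suc n) * x n * Hser a c d q (q ^ Suc n) =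
    x 1 * Hser a c d q 1 + (- a + c * q) * x 0 * Hser a c d q q"
proof (induction n)
  case (Suc n)
  have D: "Hser a c d q (q ^ n) = (1 + a + d * q ^ Suc n) * Hser a c d q (q ^ Suc n)
    + (- a + c * q ^ Suc (Suc n)) * Hser a c d q (q ^ Suc (Suc n))"
    using Hser_functional_equation [OF assms(1,2), of c d "q ^ n"]
    by (simp add: power2_eq_square mult_ac)
  have x: "x (Suc (Suc n)) = (1 + a + d * q ^ Suc n) * x (Suc n) + (- a + c * q ^ Suc n) * x n"
    using assms(3) unfolding Hrec_def by blast
  have "x (Suc (Suc n)) * Hser a c d q (q ^ Suc n)
      + (- a + c * q ^ Suc (Suc n)) * x (Suc n) * Hser a c d q (q ^ Suc (Suc n)) =
    x (Suc n) * Hser a c d q (q ^ n) + (- a + c * q ^ Suc n) * x n * Hser a c d q (q ^ Suc n)"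
    unfolding D x by (simp only: algebra_simps)
  with Suc.IH show ?case by simp
qed simp

text \<open>Eventually the norms shrink by a fixed factor \<open>k < 1\<close> up to an arbitrarily
  small error.\<close>

lemma contraction_tendsto_0:
  fixes x r e :: "nat \<Rightarrow> 'a :: real_normed_div_algebra"
  assumes "\<And>n. x (Suc n) = r n * x n + e n" "r \<longlonglongrightarrow> a" "norm a < 1" "e \<longlonglongrightarrow> 0"
  shows "x \<longlonglongrightarrow> 0"
proof -
  obtain k where k: "norm a < k" "k < 1"
    using assms(3) dense by blast
  have "\<forall>\<^sub>F n in sequentially. norm (r n) < k"
    using tendsto_norm [OF assms(2)] k(1) by (rule order_tendstoD)
  then obtain M where M: "\<And>n. n \<ge> M \<Longrightarrow> norm (r n) < k"
    by (auto simp: eventually_sequentially)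
  have k0: "k > 0"
    using k norm_ge_zero [of a] by linarith
  show ?thesis
  proof (rule LIMSEQ_I)
    fix \<epsilon> :: real assume \<epsilon>: "\<epsilon> > 0"
    \<comment> \<open>Chosen so that \<open>\<epsilon> / 2\<close> is the fixed point of the map
      taking y to \<open>k * y + \<delta>\<close>.\<close>
    define \<delta> where "\<delta> = \<epsilon> * (1 - k) / 2"
    have "\<delta> > 0" using \<epsilon> k by (simp add: \<delta>_def)
    then have "\<forall>\<^sub>F n in sequentially. norm (e n) < \<delta>"
      using order_tendstoD(2) [OF tendsto_norm [OF assms(4)]] by simp
    then obtain M' where M': "\<And>n. n \<ge> M' \<Longrightarrow> norm (e n) < \<delta>"
      by (auto simp: eventually_sequentially)
    define L where "L = max M M'"
    have bound: "norm (x (L + n)) \<le> k ^ n * norm (x L) + \<epsilon> / 2" for n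
    proof (induction n)
      case (Suc n)
      have "norm (x (L + Suc n)) \<le> norm (r (L + n)) * norm (x (L + n)) + norm (e (L + n))"
        using assms(1) [of "L + n"] by (simp add: norm_mult [symmetric] norm_triangle_ineq)
      also have "\<dots> \<le> k * norm (x (L + n)) + \<delta>"
        using M [of "L + n"] M' [of "L + n"]
        by (intro add_mono mult_right_mono) (auto simp: L_def intro: less_imp_le)
      also have "\<dots> \<le> k * (k ^ n * norm (x L) + \<epsilon> / 2) + \<delta>"
        using Suc k0 by simp
      also have "\<dots> = k ^ Suc n * norm (x L) + \<epsilon> / 2"
        by (simp add: \<delta>_def field_simps)
      finally show ?case .
    qed (use \<epsilon> in simp)
    have "(\<lambda>n. k ^ n * norm (x L)) \<longlonglongrightarrow> 0 * norm (x L)"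
      using k0 k by (intro tendsto_intros LIMSEQ_power_zero) auto
    then have "\<forall>\<^sub>F n in sequentially. k ^ n * norm (x L) < \<epsilon> / 2"
      using \<epsilon> by (intro order_tendstoD(2)) auto
    then obtain n0 where n0: "\<And>n. n \<ge> n0 \<Longrightarrow> k ^ n * norm (x L) < \<epsilon> / 2"
      by (auto simp: eventually_sequentially)
    show "\<exists>no. \<forall>n\<ge>no. norm (x n - 0) < \<epsilon>"
    proof (intro exI allI impI)
      fix n assume "n \<ge> L + n0"
      then show "norm (x n - 0) < \<epsilon>"
        using bound [of "n - L"] n0 [of "n - L"] by (simp add: le_diff_conv2)
    qed
  qed
qed

text \<open>Solving the first integral for \<open>x (Suc n)\<close> gives a first-order recurrence
  whose coefficient tends to \<open>a\<close>, so the distance to the limit contracts.\<close>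

lemma Hrec_tendsto:
  assumes "cmod a < 1" "cmod q < 1" "Hrec a c d q x"
  shows "x \<longlonglongrightarrow> x 1 * Hser a c d q 1 + (- a + c * q) * x 0 * Hser a c d q q"
    (is "_ \<longlonglongrightarrow> ?L")
proof -
  let ?D = "\<lambda>n. Hser a c d q (q ^ n)"
  have a1: "1 - a \<noteq> 0" using assms(1) by auto
  have D: "?D \<longlonglongrightarrow> 1 / (1 - a)"
    by (rule Hser_power_tendsto [OF assms(1,2)])
  then have "\<forall>\<^sub>F n in sequentially. ?D n \<noteq> 0"
    using a1 by (intro tendsto_imp_eventually_ne) auto
  then obtain M where M: "\<And>n. n \<ge> M \<Longrightarrow> ?D n \<noteq> 0"
    by (auto simp: eventually_sequentially)
  define r where "r = (\<lambda>n. (a - c * q ^ Suc (n + M)) * ?D (Suc (n + M)) / ?D (n + M))"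
  have "r \<longlonglongrightarrow> (a - c * 0) * (1 / (1 - a)) / (1 / (1 - a))"
    unfolding r_def using a1 assms(2)
    by (intro tendsto_intros LIMSEQ_ignore_initial_segment [OF D]
        LIMSEQ_ignore_initial_segment [OF LIMSEQ_Suc [OF D]]
        LIMSEQ_ignore_initial_segment [OF LIMSEQ_Suc [OF LIMSEQ_power_zero]]) auto
  then have r: "r \<longlonglongrightarrow> a" using a1 by simp
  \<comment> \<open>The error left when the first-order recurrence is rewritten for
    \<open>x - ?L\<close>.\<close>
  define e where "e = (\<lambda>n. ?L / ?D (n + M) - (1 - r n) * ?L)"
  have "e \<longlonglongrightarrow> ?L / (1 / (1 - a)) - (1 - a) * ?L"
    unfolding e_def using a1 by (intro tendsto_intros r LIMSEQ_ignore_initial_segment [OF D]) auto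
  then have e: "e \<longlonglongrightarrow> 0" by simp
  have "(\<lambda>n. x (n + M) - ?L) \<longlonglongrightarrow> 0"
  proof (rule contraction_tendsto_0 [OF _ r assms(1) e])
    fix n
    have nz: "?D (n + M) \<noteq> 0" using M by simp
    have "x (Suc (n + M)) = (?L - (- a + c * q ^ Suc (n + M)) * x (n + M) * ?D (Suc (n + M))) / ?D (n + M)"
      using nz unfolding Hrec_invariant [OF assms, of "n + M", symmetric] by simp
    also have "\<dots> = r n * x (n + M) + ?L / ?D (n + M)"
      by (simp add: r_def diff_divide_distrib [symmetric] add_divide_distrib [symmetric] algebra_simps)
    finally show "x (Suc n + M) - ?L = r n * (x (n + M) - ?L) + e n"
      by (simp add: e_def algebra_simps)
  qed
  then have "(\<lambda>n. x (n + M)) \<longlonglongrightarrow> ?L"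
    by (simp add: LIM_zero_iff)
  then show ?thesis
    by (simp add: LIMSEQ_offset)
qed

subsection \<open>Explicit formulas for the convergents\<close>

lemma Hgen_nth:
  assumes "n \<le> N"
  shows "Hgen a b c d q n $ N = (\<Sum>l=0..N-n. \<Sum>j=0..N-n-l. q ^ (n * (n + 1) div 2) *
    (qbin q c d n $ l * (qgeom q a n $ j * qgeom q b n $ (N - n - l - j))))"
  using assms unfolding Hgen_def fps_mult_left_const_nth fps_X_power_mult_nth
  unfolding fps_mult_nth by (simp add: sum_distrib_left)

text \<open>The second Gaussian binomial restricts the sum to \<open>j + l + n \<le> N\<close>,
  where it is the Cauchy product of the three factors of \<open>Hgen\<close>, summed over n.\<close>

lemma H_num_eq_infsum:
  "H_num a b c d q (Suc N) =
    (\<Sum>\<^sub>\<infinity>(j, l, n) \<in> (UNIV :: (nat \<times> nat \<times> nat) set).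
       a ^ j * b powi (int N - int n - int j - int l) * c ^ l * d powi (int n - int l)
       * q ^ (n * (n + 1) div 2 + l * (l + 1) div 2)
       * gauss_binomial q (int n + int j) (int j)
       * gauss_binomial q (int N - int j - int l) (int n)
       * gauss_binomial q (int n) (int l))"
proof -
  define t where "t = (\<lambda>(j, l, n). a ^ j * b powi (int N - int n - int j - int l) * c ^ l *
       d powi (int n - int l) * q ^ (n * (n + 1) div 2 + l * (l + 1) div 2)
       * gauss_binomial q (int n + int j) (int j)
       * gauss_binomial q (int N - int j - int l) (int n)
       * gauss_binomial q (int n) (int l))"
  define F where "F = {(j, l, n). j + l + n \<le> N}"
  define S where "S = Sigma {..N} (\<lambda>n. Sigma {0..N-n} (\<lambda>l. {0..N-n-l}))"
  have "F \<subseteq> {..N} \<times> {..N} \<times> {..N}"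
    by (auto simp: F_def)
  then have F: "finite F"
    by (rule finite_subset) auto
  have "t x = 0" if "x \<notin> F" for x
  proof -
    obtain j l n where x: "x = (j, l, n)" by (cases x)
    then have "\<not> int n \<le> int N - int j - int l"
      using that by (simp add: F_def)
    then show ?thesis by (simp add: x t_def gauss_binomial_def)
  qed
  then have "infsum t UNIV = infsum t F"
    by (intro infsum_cong_neutral) auto
  also have "\<dots> = sum t F"
    using F by simp
  also have "\<dots> = sum (\<lambda>(n, l, j). t (j, l, n)) S"
    by (rule sum.reindex_bij_witness [of _ "\<lambda>(n, l, j). (j, l, n)" "\<lambda>(j, l, n). (n, l, j)"])
      (auto simp: F_def S_def)
  also have "\<dots> = (\<Sum>n\<le>N. \<Sum>l=0..N-n. \<Sum>j=0..N-n-l. t (j, l, n))"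
    unfolding S_def by (simp add: sum.Sigma)
  also have "\<dots> = (\<Sum>n\<le>N. Hgen a b c d q n $ N)"
  proof (intro sum.cong refl)
    fix n assume "n \<in> {..N}"
    then have n: "n \<le> N" by simp
    show "(\<Sum>l=0..N-n. \<Sum>j=0..N-n-l. t (j, l, n)) = Hgen a b c d q n $ N"
      unfolding Hgen_nth [OF n]
    proof (intro sum.cong refl)
      fix l j assume "l \<in> {0..N-n}" "j \<in> {0..N-n-l}"
      define i where "i = N - n - l - j"
      have N: "N = i + j + l + n"
        using \<open>l \<in> _\<close> \<open>j \<in> _\<close> n by (auto simp: i_def)
      show "t (j, l, n) = q ^ (n * (n + 1) div 2) *
        (qbin q c d n $ l * (qgeom q a n $ j * qgeom q b n $ (N - n - l - j)))"
      proof (cases "l \<le> n")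
        case True
        have 1: "gauss_binomial q (int n + int j) (int j) = gbin q (n + j) j"
          by (simp flip: gauss_binomial_of_nat)
        have "gauss_binomial q (int N - int j - int l) (int n) = gbin q (n + i) n"
          by (simp add: N algebra_simps flip: gauss_binomial_of_nat)
        \<comment> \<open>The statement has lower index n, the coefficients of \<open>qgeom\<close>
          have i.\<close>
        also have "\<dots> = gbin q (n + i) i"
          using gbin_symmetric [of n "n + i" q] by simp
        finally have 2: "gauss_binomial q (int N - int j - int l) (int n) = gbin q (n + i) i" .
        have 3: "b powi (int N - int n - int j - int l) = b ^ i"
          by (simp add: N flip: power_int_of_nat)
        have 4: "d powi (int n - int l) = d ^ (n - l)"
          using True by (simp add: of_nat_diff flip: power_int_of_nat)
        show ?thesis
          unfolding t_def prod.case 1 2 3 4 gauss_binomial_of_nat power_add i_def [symmetric]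
          by (simp add: qbin_def qgeom_def mult_ac)
      next
        \<comment> \<open>Here the exponent of \<open>d\<close> is negative, but the last Gaussian
          binomial is zero.\<close>
        case False
        then show ?thesis
          by (simp add: t_def gauss_binomial_of_nat gbin_eq_0 qbin_def)
      qed
    qed
  qed
  also have "\<dots> = H_num a b c d q (Suc N)"
    by (rule H_num_eq_sum_Hgen [OF order_refl, symmetric])
  finally show ?thesis
    by (simp add: t_def)
qed

text \<open>Replacing c, d by cq, dq shifts the coefficients of the recurrence by one index, so both
  sides satisfy the same recurrence.\<close>

lemma H_den_eq_H_num:
  "H_den a b c d q (Suc N) =
    H_num a b c d q (Suc N) + (c * q - a * b) * H_num a b (c * q) (d * q) q N"
proof (induction N rule: induct_nat_012)
  case (ge2 N)
  show ?case
    unfolding H_den_Suc_Suc [of _ _ _ _ _ "Suc N"] H_num_Suc_Suc [of _ _ _ _ _ "Suc N"]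
      H_num_Suc_Suc [of _ _ "c * q" _ _ N] ge2
    by (simp add: algebra_simps)
qed (simp_all add: H_den_0 H_den_1 H_num_0 H_num_1 H_den_Suc_Suc H_num_Suc_Suc)

lemma H_den_eq_infsum:
  "H_den a b c d q (Suc (Suc N)) = H_num a b c d q (Suc (Suc N)) + (c * q - a * b) *
    (\<Sum>\<^sub>\<infinity>(j, l, n) \<in> (UNIV :: (nat \<times> nat \<times> nat) set).
       a ^ j * b powi (int N - int n - int j - int l) * c ^ l * d powi (int n - int l)
       * q ^ (n * (n + 3) div 2 + l * (l + 1) div 2)
       * gauss_binomial q (int n + int j) (int j)
       * gauss_binomial q (int N - int j - int l) (int n)
       * gauss_binomial q (int n) (int l))"
proof -
  have "H_num a b (c * q) (d * q) q (Suc N) =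
    (\<Sum>\<^sub>\<infinity>(j, l, n) \<in> (UNIV :: (nat \<times> nat \<times> nat) set).
       a ^ j * b powi (int N - int n - int j - int l) * c ^ l * d powi (int n - int l)
       * q ^ (n * (n + 3) div 2 + l * (l + 1) div 2)
       * gauss_binomial q (int n + int j) (int j)
       * gauss_binomial q (int N - int j - int l) (int n)
       * gauss_binomial q (int n) (int l))"
    unfolding H_num_eq_infsum
  proof (rule infsum_cong, clarify)
    fix j l n :: nat
    show "a ^ j * b powi (int N - int n - int j - int l) * (c * q) ^ l * (d * q) powi (int n - int l)
       * q ^ (n * (n + 1) div 2 + l * (l + 1) div 2)
       * gauss_binomial q (int n + int j) (int j)
       * gauss_binomial q (int N - int j - int l) (int n)
       * gauss_binomial q (int n) (int l) =
       a ^ j * b powi (int N - int n - int j - int l) * c ^ l * d powi (int n - int l)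
       * q ^ (n * (n + 3) div 2 + l * (l + 1) div 2)
       * gauss_binomial q (int n + int j) (int j)
       * gauss_binomial q (int N - int j - int l) (int n)
       * gauss_binomial q (int n) (int l)"
    proof (cases "l \<le> n")
      case True
      have 1: "x powi (int n - int l) = x ^ (n - l)" for x :: complex
        using True by (simp add: of_nat_diff flip: power_int_of_nat)
      \<comment> \<open>Of the n additional factors q, l come from the powers of cq and n - l from
        those of dq.\<close>
      have 2: "n * (n + 3) div 2 = n * (n + 1) div 2 + l + (n - l)"
        using True by (simp add: algebra_simps)
      show ?thesis
        unfolding 1 2 power_add power_mult_distrib by (simp add: mult_ac)
    next
      case False
      then show ?thesis
        by (simp add: gauss_binomial_of_nat gbin_eq_0)
    qed
  qed
  then show ?thesis
    unfolding H_den_eq_H_num [of _ _ _ _ _ "Suc N"] by simp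
qed

subsection \<open>Convergence of the continued fraction\<close>

lemma H_num_Hrec: "b \<noteq> 0 \<Longrightarrow> Hrec (a / b) (c / b\<^sup>2) (d / b) q (\<lambda>n. H_num a b c d q n / b ^ n)"
  by (simp add: Hrec_def H_num_Suc_Suc field_simps power2_eq_square)

lemma H_den_Hrec: "b \<noteq> 0 \<Longrightarrow> Hrec (a / b) (c / b\<^sup>2) (d / b) q (\<lambda>n. H_den a b c d q n / b ^ n)"
  by (simp add: Hrec_def H_den_Suc_Suc field_simps power2_eq_square)

lemma H_term_sums:
  assumes "cmod (a / b) < 1" "cmod q < 1"
  shows "H_term 1 a b c d q sums Hser (a / b) (c / b\<^sup>2) (d / b) q 1"
    and "H_term 3 a b c d q sums Hser (a / b) (c / b\<^sup>2) (d / b) q q"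
proof -
  have *: "(\<lambda>n. H_term 1 a b c d q n * z ^ n) sums Hser (a / b) (c / b\<^sup>2) (d / b) q z" for z
    unfolding Hser_def H_term_scale [of 1 a b]
    by (rule summable_sums [OF summable_H_term [OF assms]])
  show "H_term 1 a b c d q sums Hser (a / b) (c / b\<^sup>2) (d / b) q 1"
    using * [of 1] by simp
  show "H_term 3 a b c d q sums Hser (a / b) (c / b\<^sup>2) (d / b) q q"
    using * [of q] by (simp add: H_term_3 [abs_def])
qed

text \<open>The initial values are 0 and 1/b, so only the first series remains in the limit.\<close>

lemma H_num_tendsto:
  assumes "b \<noteq> 0" "cmod (a / b) < 1" "cmod q < 1"
  shows "(\<lambda>n. H_num a b c d q n / b ^ n) \<longlonglongrightarrow> (\<Sum>n. H_term 1 a b c d q n) / b"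
  using Hrec_tendsto [OF assms(2,3) H_num_Hrec [OF assms(1)], of c d]
    sums_unique [OF H_term_sums(1) [OF assms(2,3)], of c d, symmetric]
  by (simp add: H_num_0 H_num_1)

lemma H_den_tendsto:
  assumes "b \<noteq> 0" "cmod (a / b) < 1" "cmod q < 1"
  shows "(\<lambda>n. H_den a b c d q n / b ^ n) \<longlonglongrightarrow>
    ((\<Sum>n. H_term 1 a b c d q n) + (c * q / b - a) * (\<Sum>n. H_term 3 a b c d q n)) / b"
proof -
  have "(- (a / b) + c / b\<^sup>2 * q) = (c * q / b - a) / b"
    using assms(1) by (simp add: field_simps power2_eq_square)
  then show ?thesis
    using Hrec_tendsto [OF assms(2,3) H_den_Hrec [OF assms(1)], of c d]
      sums_unique [OF H_term_sums(1) [OF assms(2,3)], of c d, symmetric]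
      sums_unique [OF H_term_sums(2) [OF assms(2,3)], of c d, symmetric]
    by (simp add: H_den_0 H_den_1 add_divide_distrib)
qed

section \<open>The degenerate case in which both limits vanish\<close>

lemma H_Casoratian:
  "H_num a b c d q (Suc n) * H_den a b c d q n - H_num a b c d q n * H_den a b c d q (Suc n) =
    (\<Prod>i<n. a * b - c * q ^ Suc i)"
proof (induction n)
  case (Suc n)
  show ?case
    unfolding prod.lessThan_Suc Suc.IH [symmetric] H_num_Suc_Suc H_den_Suc_Suc
    by (simp add: algebra_simps)
qed (simp add: H_num_0 H_num_1 H_den_0 H_den_1)

text \<open>As long as \<open>\<alpha>\<close> is nonzero, two consecutive zeros would propagate
  backwards to \<open>m\<close>.\<close>

lemma consecutive_nonzero_propagate:
  fixes x :: "nat \<Rightarrow> 'a :: idom"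
  assumes "\<And>n. x (Suc (Suc n)) = \<beta> n * x (Suc n) + \<alpha> n * x n"
    and "\<And>n. n \<ge> m \<Longrightarrow> \<alpha> n \<noteq> 0" "x m \<noteq> 0" "n \<ge> m"
  shows "x n \<noteq> 0 \<or> x (Suc n) \<noteq> 0"
  using assms(4) by (induction rule: dec_induct) (use assms in auto)

text \<open>The partial numerators vanish never, always, or for exactly one index. In the last case
  the Casoratian provides a nonzero starting value just after that index. In the excluded case both
  sequences are eventually zero.\<close>

lemma H_consecutive_nonzero:
  assumes "b \<noteq> 0" "cmod q < 1" and not_excl: "\<not> (a = 0 \<and> c = 0 \<and> (\<exists>k\<ge>1. b + d * q ^ k = 0))"
  obtains x m where "x = H_num a b c d q \<or> x = H_den a b c d q"
    "\<And>n. n \<ge> m \<Longrightarrow> x n \<noteq> 0 \<or> x (Suc n) \<noteq> 0"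
proof -
  let ?A = "H_num a b c d q" and ?B = "H_den a b c d q"
  define \<alpha> where "\<alpha> = (\<lambda>n. - a * b + c * q ^ Suc n)"
  note result = that
  have propagate: thesis if "x = ?A \<or> x = ?B" "x m \<noteq> 0" "\<And>n. n \<ge> m \<Longrightarrow> \<alpha> n \<noteq> 0" for x m
  proof (rule result [OF that(1)])
    fix n assume "n \<ge> m"
    with that show "x n \<noteq> 0 \<or> x (Suc n) \<noteq> 0"
      by (intro consecutive_nonzero_propagate [of x "\<lambda>n. a + b + d * q ^ Suc n" \<alpha> m])
        (auto simp: \<alpha>_def H_num_Suc_Suc H_den_Suc_Suc)
  qed
  consider "\<And>n. \<alpha> n \<noteq> 0" | "a = 0" "c = 0 \<or> q = 0"
    | k where "\<alpha> k = 0" "\<not> (a = 0 \<and> (c = 0 \<or> q = 0))" by blast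
  then show thesis
  proof cases
    case 1
    then show ?thesis
      using propagate [of ?B 0] by (simp add: H_den_0)
  next
    case 2
    \<comment> \<open>For \<open>c = 0\<close> this is the excluded case; otherwise
      \<open>q = 0\<close> and the sum is \<open>b\<close>.\<close>
    have nz: "b + d * q ^ Suc n \<noteq> 0" for n
      using 2 not_excl assms(1) by (cases "c = 0") auto
    have "?A (Suc n) \<noteq> 0" for n
    proof (induction n)
      case (Suc n)
      have "?A (Suc (Suc n)) = (b + d * q ^ Suc n) * ?A (Suc n)"
        using 2 by (auto simp: H_num_Suc_Suc)
      then show ?case
        using Suc nz by (metis mult_eq_0_iff)
    qed (simp add: H_num_1)
    then show ?thesis
      using result [of ?A 0] by blast
  next
    case 3
    have unique: "i = k" if "\<alpha> i = 0" for i
    proof (rule ccontr)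
      assume "i \<noteq> k"
      have "c * q ^ Suc i = c * q ^ Suc k"
        using that 3(1) by (simp add: \<alpha>_def add_eq_0_iff)
      moreover have "c * q \<noteq> 0"
        using 3 assms(1) by (auto simp: \<alpha>_def)
      ultimately have "q ^ i = q ^ k" "q \<noteq> 0" by auto
      then have "cmod q ^ i = cmod q ^ k" "cmod q > 0"
        by (metis norm_power, simp)
      then show False
        using assms(2) \<open>i \<noteq> k\<close> power_strict_decreasing [of i k "cmod q"]
          power_strict_decreasing [of k i "cmod q"] by (cases "i < k") auto
    qed
    \<comment> \<open>The only vanishing factor would have index k, which lies outside the
      range.\<close>
    have "(\<Prod>i<k. a * b - c * q ^ Suc i) \<noteq> 0"
      using unique by (force simp: \<alpha>_def)
    then have "?A (Suc k) \<noteq> 0 \<or> ?B (Suc k) \<noteq> 0"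
      using H_Casoratian [of a b c d q k] by auto
    moreover have "\<alpha> n \<noteq> 0" if "n \<ge> Suc k" for n
      using unique [of n] that by auto
    ultimately show ?thesis
      using propagate by blast
  qed
qed

text \<open>When both limits vanish, the first integral is zero and the numerators and denominators satisfy one
  common first-order recurrence, so that their quotient is eventually constant.\<close>

lemma H_degenerate:
  assumes "b \<noteq> 0" "cmod (a / b) < 1" "cmod q < 1"
    and "\<not> (a = 0 \<and> c = 0 \<and> (\<exists>k\<ge>1. b + d * q ^ k = 0))"
    and "(\<Sum>n. H_term 1 a b c d q n) = 0" "(c * q / b - a) * (\<Sum>n. H_term 3 a b c d q n) = 0"
  shows "H_converges a b c d q \<or> H_tends_to_infinity a b c d q"
proof -
  let ?A = "H_num a b c d q" and ?B = "H_den a b c d q"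
  let ?D = "\<lambda>n. Hser (a / b) (c / b\<^sup>2) (d / b) q (q ^ n)"
  have "1 - a / b \<noteq> 0" using assms(2) by auto
  then have "\<forall>\<^sub>F n in sequentially. ?D n \<noteq> 0"
    by (intro tendsto_imp_eventually_ne [OF Hser_power_tendsto [OF assms(2,3)]]) simp
  then obtain M where M: "\<And>n. n \<ge> M \<Longrightarrow> ?D n \<noteq> 0"
    by (auto simp: eventually_sequentially)
  \<comment> \<open>The ratio obtained by setting the first integral to zero; the factor
    \<open>b\<close> undoes the scaling.\<close>
  define \<rho> where "\<rho> = (\<lambda>n. - (b * (- (a / b) + c / b\<^sup>2 * q ^ Suc n) * ?D (Suc n) / ?D n))"
  have first_order: "x (Suc n) = \<rho> n * x n"
    if "Hrec (a / b) (c / b\<^sup>2) (d / b) q (\<lambda>n. x n / b ^ n)" "(\<lambda>n. x n / b ^ n) \<longlonglongrightarrow> 0" "n \<ge> M" for x n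
  proof -
    have "x (Suc n) / b ^ Suc n * ?D n
        + (- (a / b) + c / b\<^sup>2 * q ^ Suc n) * (x n / b ^ n) * ?D (Suc n) = 0"
      using Hrec_invariant [OF assms(2,3) that(1), of n]
        LIMSEQ_unique [OF Hrec_tendsto [OF assms(2,3) that(1)] that(2)] by simp
    then have "x (Suc n) / b ^ Suc n * ?D n =
        - ((- (a / b) + c / b\<^sup>2 * q ^ Suc n) * (x n / b ^ n) * ?D (Suc n))"
      by (simp only: add_eq_0_iff2)
    then have "x (Suc n) * ?D n = - (b * (- (a / b) + c / b\<^sup>2 * q ^ Suc n) * x n * ?D (Suc n))"
      using assms(1) by (simp add: divide_simps mult_ac)
    then show ?thesis
      using M [OF that(3)] unfolding nonzero_eq_divide_eq [OF M [OF that(3)], symmetric]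
      by (simp add: \<rho>_def mult_ac)
  qed
  have A: "?A (Suc n) = \<rho> n * ?A n" if "n \<ge> M" for n
    using H_num_tendsto [OF assms(1-3), of c d] assms(5) that
    by (intro first_order H_num_Hrec assms(1)) auto
  have B: "?B (Suc n) = \<rho> n * ?B n" if "n \<ge> M" for n
    using H_den_tendsto [OF assms(1-3), of c d] assms(5,6) that
    by (intro first_order H_den_Hrec assms(1)) auto
  obtain x m where x: "x = ?A \<or> x = ?B" "\<And>n. n \<ge> m \<Longrightarrow> x n \<noteq> 0 \<or> x (Suc n) \<noteq> 0"
    using H_consecutive_nonzero [OF assms(1,3,4)] by blast
  define K where "K = max m M"
  \<comment> \<open>By the first-order recurrence a zero at \<open>n\<close> would entail one at
    \<open>Suc n\<close>.\<close>
  have nz: "x n \<noteq> 0" if "n \<ge> K" for n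
    using x(1) x(2) [of n] A [of n] B [of n] that by (auto simp: K_def)
  have cross: "?A n * ?B K = ?A K * ?B n" if "n \<ge> K" for n
    using that by (induction rule: dec_induct) (auto simp: A B K_def)
  show ?thesis
  proof (cases "?B K = 0")
    case True
    then have "x = ?A" using x(1) nz [of K] by auto
    with nz have AK: "?A n \<noteq> 0" if "n \<ge> K" for n
      using that by blast
    then have "?B n / ?A n = 0" if "n \<ge> K" for n
      using cross [OF that] True by simp
    then have "(\<lambda>n. ?B n / ?A n) \<longlonglongrightarrow> 0"
      by (intro tendsto_eventually) (auto simp: eventually_sequentially)
    moreover have "\<forall>\<^sub>F n in sequentially. ?A n \<noteq> 0"
      using AK by (auto simp: eventually_sequentially)
    ultimately show ?thesis
      by (simp add: H_tends_to_infinity_def cf_tends_to_infinity_def H_num_def H_den_def)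
  next
    case False
    \<comment> \<open>If \<open>x\<close> is \<open>?A\<close>, a zero of \<open>?B n\<close> would
      contradict \<open>cross\<close>, since \<open>?A n * ?B K\<close> is nonzero.\<close>
    have BK: "?B n \<noteq> 0" if "n \<ge> K" for n
      using x(1) nz [OF that] cross [OF that] False by auto
    have "?A n / ?B n = ?A K / ?B K" if "n \<ge> K" for n
      by (subst frac_eq_eq) (fact BK [OF that] False cross [OF that])+
    then have "(\<lambda>n. ?A n / ?B n) \<longlonglongrightarrow> ?A K / ?B K"
      by (intro tendsto_eventually eventually_sequentiallyI)
    then have "convergent (\<lambda>n. ?A n / ?B n)"
      by (rule convergentI)
    moreover have "\<forall>\<^sub>F n in sequentially. ?B n \<noteq> 0"
      using BK by (auto simp: eventually_sequentially)
    ultimately show ?thesis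
      by (simp add: H_converges_def cf_converges_def H_num_def H_den_def)
  qed
qed

section \<open>Quotients of the convergents in terms of the two series\<close>

lemma H_converges_if:
  assumes "b \<noteq> 0" "(\<lambda>n. H_num a b c d q n / b ^ n) \<longlonglongrightarrow> A"
    "(\<lambda>n. H_den a b c d q n / b ^ n) \<longlonglongrightarrow> B" "B \<noteq> 0"
  shows "H_converges a b c d q" "H_value a b c d q = A / B"
proof -
  have "\<forall>\<^sub>F n in sequentially. H_den a b c d q n / b ^ n \<noteq> 0"
    using assms(3,4) by (rule tendsto_imp_eventually_ne)
  then have "\<forall>\<^sub>F n in sequentially. H_den a b c d q n \<noteq> 0"
    by eventually_elim auto
  moreover have "(\<lambda>n. (H_num a b c d q n / b ^ n) / (H_den a b c d q n / b ^ n)) \<longlonglongrightarrow> A / B"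
    using assms by (intro tendsto_divide)
  then have "(\<lambda>n. H_num a b c d q n / H_den a b c d q n) \<longlonglongrightarrow> A / B"
    using assms(1) by simp
  ultimately show "H_converges a b c d q" "H_value a b c d q = A / B"
    by (auto simp: H_converges_def cf_converges_def H_value_def cf_value_def H_num_def H_den_def
        convergent_def limI)
qed

lemma H_tends_to_infinity_if:
  assumes "b \<noteq> 0" "(\<lambda>n. H_num a b c d q n / b ^ n) \<longlonglongrightarrow> A"
    "(\<lambda>n. H_den a b c d q n / b ^ n) \<longlonglongrightarrow> 0" "A \<noteq> 0"
  shows "H_tends_to_infinity a b c d q"
proof -
  have "\<forall>\<^sub>F n in sequentially. H_num a b c d q n / b ^ n \<noteq> 0"
    using assms(2,4) by (rule tendsto_imp_eventually_ne)
  then have "\<forall>\<^sub>F n in sequentially. H_num a b c d q n \<noteq> 0"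
    by eventually_elim auto
  moreover have "(\<lambda>n. (H_den a b c d q n / b ^ n) / (H_num a b c d q n / b ^ n)) \<longlonglongrightarrow> 0 / A"
    using assms by (intro tendsto_divide)
  then have "(\<lambda>n. H_den a b c d q n / H_num a b c d q n) \<longlonglongrightarrow> 0"
    using assms(1) by simp
  ultimately show ?thesis
    by (auto simp: H_tends_to_infinity_def cf_tends_to_infinity_def H_num_def H_den_def)
qed

text \<open>The scaled limits D/b and (D + E)/b determine the limit D/(D + E) on the Riemann sphere
  unless both vanish.\<close>

lemma H_limit:
  fixes a b c d q :: complex
  defines "D \<equiv> (\<Sum>n. H_term 1 a b c d q n)"
    and "E \<equiv> (c * q / b - a) * (\<Sum>n. H_term 3 a b c d q n)"
  assumes "b \<noteq> 0" "cmod (a / b) < 1" "cmod q < 1"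
  shows "D \<noteq> 0 \<Longrightarrow> D + E \<noteq> 0 \<Longrightarrow> H_converges a b c d q \<and> 1 / H_value a b c d q - 1 = E / D"
    and "D \<noteq> 0 \<Longrightarrow> D + E = 0 \<Longrightarrow> H_tends_to_infinity a b c d q"
    and "D = 0 \<Longrightarrow> E \<noteq> 0 \<Longrightarrow> H_converges a b c d q \<and> H_value a b c d q = 0"
proof -
  have num: "(\<lambda>n. H_num a b c d q n / b ^ n) \<longlonglongrightarrow> D / b"
    unfolding D_def using assms(3-5) by (rule H_num_tendsto)
  have den: "(\<lambda>n. H_den a b c d q n / b ^ n) \<longlonglongrightarrow> (D + E) / b"
    unfolding D_def E_def using assms(3-5) by (rule H_den_tendsto)
  note conv = H_converges_if [OF assms(3) num den]
  show "H_converges a b c d q \<and> 1 / H_value a b c d q - 1 = E / D" if "D \<noteq> 0" "D + E \<noteq> 0"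
  proof
    have "H_value a b c d q = D / (D + E)"
      using conv(2) that assms(3) by simp
    then show "1 / H_value a b c d q - 1 = E / D"
      using that by (simp add: add_divide_distrib)
  qed (use conv(1) that assms(3) in simp)
  show "D \<noteq> 0 \<Longrightarrow> D + E = 0 \<Longrightarrow> H_tends_to_infinity a b c d q"
    using H_tends_to_infinity_if [OF assms(3) num] den assms(3) by simp
  show "D = 0 \<Longrightarrow> E \<noteq> 0 \<Longrightarrow> H_converges a b c d q \<and> H_value a b c d q = 0"
    using conv assms(3) by simp
qed

theorem theorem2p2:
  fixes a b c d q :: complex
  shows
    "(\<forall>N\<ge>1. H_num a b c d q N =
        (\<Sum>\<^sub>\<infinity>(j, l, n) \<in> (UNIV :: (nat \<times> nat \<times> nat) set).
           a ^ j * b powi (int N - 1 - int n - int j - int l) * c ^ l * d powi (int n - int l)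
           * q ^ (n * (n + 1) div 2 + l * (l + 1) div 2)
           * gauss_binomial q (int n + int j) (int j)
           * gauss_binomial q (int N - 1 - int j - int l) (int n)
           * gauss_binomial q (int n) (int l)))
   \<and> (\<forall>N\<ge>2. H_den a b c d q N = H_num a b c d q N + (c * q - a * b) *
        (\<Sum>\<^sub>\<infinity>(j, l, n) \<in> (UNIV :: (nat \<times> nat \<times> nat) set).
           a ^ j * b powi (int N - 2 - int n - int j - int l) * c ^ l * d powi (int n - int l)
           * q ^ (n * (n + 3) div 2 + l * (l + 1) div 2)
           * gauss_binomial q (int n + int j) (int j)
           * gauss_binomial q (int N - 2 - int j - int l) (int n)
           * gauss_binomial q (int n) (int l)))
   \<and> (b \<noteq> 0 \<and> cmod (a / b) < 1 \<and> cmod q < 1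
       \<and> \<not> (a = 0 \<and> c = 0 \<and> (\<exists>k\<ge>1. b + d * q ^ k = 0)) \<longrightarrow>
        summable (H_term 1 a b c d q) \<and> summable (H_term 3 a b c d q)
        \<and> (let D = (\<Sum>n. H_term 1 a b c d q n);
               E = (c * q / b - a) * (\<Sum>n. H_term 3 a b c d q n)
           in (H_converges a b c d q \<or> H_tends_to_infinity a b c d q)
            \<and> (D \<noteq> 0 \<and> D + E \<noteq> 0 \<longrightarrow>
                 H_converges a b c d q \<and> 1 / H_value a b c d q - 1 = E / D)
            \<and> (D \<noteq> 0 \<and> D + E = 0 \<longrightarrow> H_tends_to_infinity a b c d q)
            \<and> (D = 0 \<and> E \<noteq> 0 \<longrightarrow> H_converges a b c d q \<and> H_value a b c d q = 0)))
   \<and> (cmod q < 1 \<and> cmod a < 1 \<and> b = 1 \<longrightarrow>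
        (let s = (\<lambda>e n. (\<Prod>k<n. d + c * q ^ (k + 1)) * q ^ (n * (n + e) div 2) /
                         (qpoch a q (n + 1) * qpoch q q n))
         in summable (s 1) \<and> summable (s 3)
          \<and> H_num a b c d q \<longlonglongrightarrow> (\<Sum>n. s 1 n)
          \<and> H_den a b c d q \<longlonglongrightarrow> (\<Sum>n. s 1 n) + (c * q - a) * (\<Sum>n. s 3 n)))"
proof (intro conjI allI impI, goal_cases)
  case (1 N)
  then obtain M where "N = Suc M" by (cases N) auto
  then show ?case
    using H_num_eq_infsum [of a b c d q M] by simp
next
  case (2 N)
  then obtain M where "N = Suc (Suc M)"
    by (metis One_nat_def Suc_1 Suc_le_D Suc_le_mono)
  then show ?case
    using H_den_eq_infsum [of a b c d q M] by simp
next
  case 3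
  then show ?case
    using H_term_sums(1) sums_summable by blast
next
  case 4
  then show ?case
    using H_term_sums(2) sums_summable by blast
next
  case 5
  then have b: "b \<noteq> 0" "cmod (a / b) < 1" "cmod q < 1" by blast+
  note lim = H_limit [OF b, of c d]
  define D where "D = (\<Sum>n. H_term 1 a b c d q n)"
  define E where "E = (c * q / b - a) * (\<Sum>n. H_term 3 a b c d q n)"
  note lim = lim [folded D_def E_def]
  \<comment> \<open>Only \<open>D = 0\<close>, \<open>E = 0\<close> is left open by
    \<open>lim\<close>; there \<open>H_degenerate\<close> applies.\<close>
  have "H_converges a b c d q \<or> H_tends_to_infinity a b c d q"
    using H_degenerate [OF b, of c d, folded D_def E_def] 5 lim by blast
  with lim show ?case
    unfolding Let_def D_def [symmetric] E_def [symmetric] by blast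
next
  case 6
  then have a: "(1 :: complex) \<noteq> 0" "cmod (a / 1) < 1" "cmod q < 1" and b: "b = 1" by auto
  have s: "(\<lambda>n. (\<Prod>k<n. d + c * q ^ (k + 1)) * q ^ (n * (n + e) div 2) /
      (qpoch a q (n + 1) * qpoch q q n)) = H_term e a 1 c d q" for e
    by (simp add: H_term_def [abs_def])
  show ?case
    unfolding Let_def b s
    using H_term_sums [OF a(2,3), of c d] H_num_tendsto [OF a, of c d] H_den_tendsto [OF a, of c d]
    by (auto simp: sums_iff)
qed

end
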